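(* Let $U$ be an absolute ultrafilter on $\mathbb{N}$ and let $x=(x_n)_{n\ge 0}$ and $y=(y_n)_{n\ge 0}$ be two sequences of real numbers. Then $U(x)=U(y)$ if and only if $\overline{x}=\overline{y}$.
   Context: $\mathbb{N}$ is the set of non-negative integers and $\mathbb{R}$ carries its usual topology. A nontrivial (i.e. non-principal, free) ultrafilter $U$ on $\mathbb{N}$ is called absolute if for every partition $(Q_n)_{n\ge 0}$ of $\mathbb{N}$ with $Q_n\notin U$ for all $n\ge 0$, there exists $A\in U$ such that $|Q_n\cap A|\le 1$ for all $n\ge 0$. For an ultrafilter $U$ on $\mathbb{N}$ and a real sequence $x=(x_n)_{n\ge 0}$, $U(x)$ denotes the collection of all open subsets $W$ of $\mathbb{R}$ such that $\{n\in\mathbb{N} \mid x_n\in W\}\in U$. Two real sequences $x,y$ are $U$-equivalent if $\{n\in\mathbb{N}\mid x_n=y_n\}\in U$; this is an equivalence relation on $\mathbb{R}^{\mathbb{N}}$, and $\overline{x}$ denotes the equivalence class of $x$ (the hyperreal, modulo $U$, associated to $x$). *)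

theory Defs
  imports Complex_Main "HOL-Library.Disjoint_Sets"
begin

text \<open>
  Ultrafilters are represented by the library type of filters: a set \<open>A\<close> belongs to the
  filter \<open>F\<close> iff \<open>eventually (\<lambda>n. n \<in> A) F\<close>. That type includes the improper filter
  \<open>bot\<close>, which contains every set and therefore has to be excluded.
\<close>

definition filter_sets :: "'a filter \<Rightarrow> 'a set set" where
  "filter_sets F = {A. eventually (\<lambda>n. n \<in> A) F}"

definition ultrafilter :: "'a filter \<Rightarrow> bool" where
  "ultrafilter F \<longleftrightarrow> F \<noteq> bot \<and> (\<forall>A. A \<in> filter_sets F \<or> - A \<in> filter_sets F)"

definition nontrivial_ultrafilter :: "'a filter \<Rightarrow> bool" where
  "nontrivial_ultrafilter F \<longleftrightarrow> ultrafilter F \<and> (\<forall>a. F \<noteq> principal {a})"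

text \<open>
  The blocks \<open>Q n\<close> of an indexed partition may be empty. This does not change the notion of
  an absolute ultrafilter: a finite partition always has a block in the ultrafilter, so only
  partitions with infinitely many nonempty blocks matter, and these can be reindexed.
  The finiteness condition is needed since \<open>card\<close> is 0 on infinite sets.
\<close>

definition absolute_ultrafilter :: "nat filter \<Rightarrow> bool" where
  "absolute_ultrafilter U \<longleftrightarrow> nontrivial_ultrafilter U \<and>
     (\<forall>Q :: nat \<Rightarrow> nat set.
        disjoint_family Q \<longrightarrow> (\<Union>n. Q n) = UNIV \<longrightarrow> (\<forall>n. Q n \<notin> filter_sets U) \<longrightarrow>
        (\<exists>A \<in> filter_sets U. \<forall>n. finite (Q n \<inter> A) \<and> card (Q n \<inter> A) \<le> 1))"

definition ultra_opens :: "nat filter \<Rightarrow> (nat \<Rightarrow> real) \<Rightarrow> real set set" where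
  "ultra_opens U x = {W. open W \<and> {n. x n \<in> W} \<in> filter_sets U}"

definition seq_equiv :: "nat filter \<Rightarrow> ((nat \<Rightarrow> real) \<times> (nat \<Rightarrow> real)) set" where
  "seq_equiv U = {(x, y). {n. x n = y n} \<in> filter_sets U}"

definition hyperreal_class :: "nat filter \<Rightarrow> (nat \<Rightarrow> real) \<Rightarrow> (nat \<Rightarrow> real) set" where
  "hyperreal_class U x = seq_equiv U `` {x}"

lemma equiv_seq_equiv: "equiv UNIV (seq_equiv U)"
proof (rule equivI)
  show "refl (seq_equiv U)"
    by (auto simp: refl_on_def seq_equiv_def filter_sets_def)
  show "sym (seq_equiv U)"
    by (auto simp: sym_def seq_equiv_def filter_sets_def eq_commute)
  show "trans (seq_equiv U)"
    unfolding trans_def seq_equiv_def filter_sets_def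
    by (auto elim: eventually_elim2)
qed auto

end

theory Submission
  imports Defs "HOL-Analysis.Elementary_Topology"
begin

text \<open>
  After composing with \<open>arctan\<close> both sequences are bounded, so each has a limit along \<open>U\<close>.
  Suppose they differ almost everywhere; the interesting case is that of a common limit \<open>L\<close>
  which neither sequence attains almost everywhere. Absoluteness, applied to the partitions
  given by \<open>\<lfloor>1 / \<bar>x n - L\<bar>\<rfloor>\<close> and \<open>\<lfloor>1 / \<bar>y n - L\<bar>\<rfloor>\<close>, yields a set in \<open>U\<close> on which both
  sequences are injective and converge to \<open>L\<close> in the ordinary sense. A parity argument thins
  it out to a set \<open>B\<close> in \<open>U\<close> for which \<open>x ` B\<close> and \<open>y ` B\<close> are disjoint; then
  the complement of the closed set \<open>insert L (y ` B)\<close> distinguishes \<open>x\<close> from \<open>y\<close>.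
\<close>

section \<open>Ultrafilters and limits along them\<close>

lemma ultrafilter_eventually_or:
  assumes "ultrafilter U"
  shows "eventually P U \<or> eventually (\<lambda>n. \<not> P n) U"
proof -
  have "Collect P \<in> filter_sets U \<or> - Collect P \<in> filter_sets U"
    using assms unfolding ultrafilter_def by blast
  then show ?thesis by (simp add: filter_sets_def)
qed

lemma ultrafilter_not_eventually_iff:
  assumes "ultrafilter U"
  shows "\<not> eventually P U \<longleftrightarrow> eventually (\<lambda>n. \<not> P n) U"
proof -
  have False if "eventually P U" "eventually (\<lambda>n. \<not> P n) U"
  proof -
    have "eventually (\<lambda>_. False) U" using that by eventually_elim simp
    then show False
      using assms by (simp add: ultrafilter_def trivial_limit_def)
  qed
  then show ?thesis using ultrafilter_eventually_or[OF assms] by blast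
qed

text \<open>Compactness gives the image filter a cluster point \<open>L\<close>. An open
  neighbourhood of \<open>L\<close> not containing \<open>x n\<close> eventually would, by the
  ultrafilter dichotomy, be avoided eventually, so \<open>L\<close> would not be a cluster
  point.\<close>

lemma ultrafilter_tendsto_compact:
  fixes x :: "'a \<Rightarrow> 'b::topological_space"
  assumes U: "ultrafilter U" and "compact K" and "\<And>n. x n \<in> K"
  obtains L where "(x \<longlongrightarrow> L) U"
proof -
  have "filtermap x U \<noteq> bot"
    using U by (simp add: ultrafilter_def filtermap_bot_iff)
  moreover have "eventually (\<lambda>t. t \<in> K) (filtermap x U)"
    using assms(3) by (simp add: eventually_filtermap)
  ultimately obtain L where L: "inf (nhds L) (filtermap x U) \<noteq> bot"
    using \<open>compact K\<close> unfolding compact_filter by blast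
  have "(x \<longlongrightarrow> L) U"
  proof (rule topological_tendstoI, rule ccontr)
    fix S assume S: "open S" "L \<in> S" and "\<not> eventually (\<lambda>n. x n \<in> S) U"
    then have "eventually (\<lambda>t. t \<notin> S) (filtermap x U)"
      using ultrafilter_not_eventually_iff[OF U] by (simp add: eventually_filtermap)
    moreover have "eventually (\<lambda>t. t \<in> S) (nhds L)"
      using S by (rule eventually_nhds_in_open)
    ultimately have "eventually (\<lambda>_. False) (inf (nhds L) (filtermap x U))"
      unfolding eventually_inf by blast
    with L show False by (simp add: trivial_limit_def)
  qed
  then show ?thesis by (rule that)
qed

section \<open>Injectivity from absoluteness\<close>

lemma absolute_ultrafilter_imp_ultrafilter:
  "absolute_ultrafilter U \<Longrightarrow> ultrafilter U"
  unfolding absolute_ultrafilter_def nontrivial_ultrafilter_def by (elim conjE)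

text \<open>The fibres of \<open>g\<close> form the partition; some may be empty, so
  \<open>g\<close> need not be surjective.\<close>

lemma absolute_ultrafilter_inj_on:
  fixes g :: "nat \<Rightarrow> nat"
  assumes "absolute_ultrafilter U" and g: "\<And>k. \<not> eventually (\<lambda>n. g n = k) U"
  obtains A where "eventually (\<lambda>n. n \<in> A) U" "inj_on g A"
proof -
  define Q where "Q k = {n. g n = k}" for k
  have "disjoint_family Q" "(\<Union>k. Q k) = UNIV" "\<forall>k. Q k \<notin> filter_sets U"
    using g by (auto simp: Q_def disjoint_family_on_def filter_sets_def)
  then obtain A where A: "eventually (\<lambda>n. n \<in> A) U"
    and Q: "\<And>k. finite (Q k \<inter> A) \<and> card (Q k \<inter> A) \<le> 1"
    using assms(1) unfolding absolute_ultrafilter_def filter_sets_def by blast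
  have "inj_on g A"
  proof (rule inj_onI)
    fix m n assume "m \<in> A" "n \<in> A" "g m = g n"
    then have "m \<in> Q (g n) \<inter> A" "n \<in> Q (g n) \<inter> A" by (auto simp: Q_def)
    with Q[of "g n"] card_le_Suc0_iff_eq[of "Q (g n) \<inter> A"] show "m = n" by auto
  qed
  with A show ?thesis by (rule that)
qed

text \<open>A single choice of \<open>A\<close> serves twice: once the integer levels
  \<open>g n\<close> are pairwise distinct on \<open>A\<close>, the values \<open>x n\<close> are
  distinct too, and only finitely many indices have a level below a given bound, that is, a value
  far from \<open>L\<close>.\<close>

lemma eventually_inj_discrete_along:
  fixes x :: "nat \<Rightarrow> real"
  assumes abs: "absolute_ultrafilter U" and lim: "(x \<longlongrightarrow> L) U"
    and ne: "eventually (\<lambda>n. x n \<noteq> L) U"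
  obtains A where "eventually (\<lambda>n. n \<in> A) U" "inj_on x A" "\<And>n. n \<in> A \<Longrightarrow> x n \<noteq> L"
    "\<And>e. e > 0 \<Longrightarrow> finite {n \<in> A. \<bar>x n - L\<bar> > e}"
proof -
  note U = absolute_ultrafilter_imp_ultrafilter[OF abs]
  define g where "g n = nat \<lfloor>1 / \<bar>x n - L\<bar>\<rfloor>" for n
  have "\<not> eventually (\<lambda>n. g n = k) U" for k
  proof -
    \<comment> \<open>Within this radius, but off \<open>L\<close>, the level is at least
      \<open>k + 1\<close>. At \<open>L\<close> itself it would be 0, since
      \<open>1 / 0 = 0\<close>; hence the appeal to \<open>ne\<close>.\<close>
    have "eventually (\<lambda>n. dist (x n) L < 1 / (real k + 1)) U"
      using lim by (rule tendstoD) simp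
    with ne have "eventually (\<lambda>n. g n \<noteq> k) U"
    proof eventually_elim
      case (elim n)
      then have "real k + 1 < 1 / \<bar>x n - L\<bar>"
        by (simp add: dist_real_def field_simps)
      then have "int k + 1 \<le> \<lfloor>1 / \<bar>x n - L\<bar>\<rfloor>" by (simp add: le_floor_iff)
      then show ?case by (simp add: g_def)
    qed
    then show ?thesis using ultrafilter_not_eventually_iff[OF U] by blast
  qed
  then obtain A where A: "eventually (\<lambda>n. n \<in> A) U" "inj_on g A"
    using absolute_ultrafilter_inj_on[OF abs] by blast
  \<comment> \<open>Injectivity of \<open>g\<close> alone does not keep out an index with
    \<open>x n = L\<close>, which sits at level 0.\<close>
  let ?A = "{n \<in> A. x n \<noteq> L}"
  have "eventually (\<lambda>n. n \<in> ?A) U"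
    using A(1) ne by eventually_elim simp
  moreover have "inj_on x ?A"
    unfolding inj_on_def g_def
  proof (intro ballI impI)
    fix m n assume "m \<in> ?A" "n \<in> ?A" "x m = x n"
    then show "m = n" using inj_onD[OF A(2), of m n] by (simp add: g_def)
  qed
  moreover have "finite {n \<in> ?A. \<bar>x n - L\<bar> > e}" if e: "e > 0" for e
  proof (rule inj_on_finite)
    show "inj_on g {n \<in> ?A. \<bar>x n - L\<bar> > e}"
      using A(2) by (rule inj_on_subset) auto
    have "g n \<le> nat \<lfloor>1 / e\<rfloor>" if "\<bar>x n - L\<bar> > e" for n
    proof -
      have "1 / \<bar>x n - L\<bar> \<le> 1 / e" using that e by (intro divide_left_mono) auto
      then show ?thesis unfolding g_def by (intro nat_mono floor_mono)
    qed
    then show "g ` {n \<in> ?A. \<bar>x n - L\<bar> > e} \<subseteq> {..nat \<lfloor>1 / e\<rfloor>}" by blast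
  qed simp
  ultimately show ?thesis by (intro that[of ?A]) auto
qed

section \<open>Thinning out until the images are disjoint\<close>

lemma exists_descent_colouring:
  fixes f :: "nat \<Rightarrow> nat"
  obtains c :: "nat \<Rightarrow> bool" where "\<And>n. f n < n \<Longrightarrow> c n \<noteq> c (f n)"
proof -
  \<comment> \<open>Joining each \<open>n\<close> to \<open>f n\<close> when \<open>f n < n\<close>
    gives a forest; \<open>c\<close> is the parity of the depth of \<open>n\<close>, with
    \<open>True\<close> at the roots.\<close>
  define c where
    "c = wfrec less_than (\<lambda>c n. if f n < n then \<not> c (f n) else True)"
  have "c n \<noteq> c (f n)" if "f n < n" for n
    using that def_wfrec[OF c_def[THEN eq_reflection] wf_less_than, of n]
    by (simp add: cut_apply)
  then show ?thesis by (rule that)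
qed

text \<open>Since \<open>y\<close> is injective on \<open>A\<close>, a coincidence
  \<open>x n = y m\<close> determines \<open>m\<close> from \<open>n\<close>, so the coincidences
  with \<open>m < n\<close> are edges of a descent graph. One of its two colour classes is in
  \<open>U\<close>, and no edge joins two points of the same class.\<close>

lemma ultrafilter_separate_below:
  fixes x y :: "nat \<Rightarrow> 'a"
  assumes U: "ultrafilter U" and A: "eventually (\<lambda>n. n \<in> A) U" and inj: "inj_on y A"
  obtains B where "eventually (\<lambda>n. n \<in> B) U" "B \<subseteq> A"
    "\<And>m n. m \<in> B \<Longrightarrow> n \<in> B \<Longrightarrow> m < n \<Longrightarrow> x n \<noteq> y m"
proof -
  define f where "f n = inv_into A y (x n)" for n
  obtain c :: "nat \<Rightarrow> bool" where c: "\<And>n. f n < n \<Longrightarrow> c n \<noteq> c (f n)"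
    using exists_descent_colouring by blast
  obtain b where b: "eventually (\<lambda>n. c n = b) U"
    using ultrafilter_eventually_or[OF U, of c] that[of True] that[of False] by auto
  let ?B = "{n \<in> A. c n = b}"
  have "eventually (\<lambda>n. n \<in> ?B) U" using A b by eventually_elim simp
  moreover have "x n \<noteq> y m" if "m \<in> ?B" "n \<in> ?B" "m < n" for m n
  proof
    assume "x n = y m"
    then have "f n = m" using inj that by (simp add: f_def)
    with c[of n] that show False by simp
  qed
  ultimately show ?thesis using that[of ?B] by blast
qed

text \<open>Two thinnings, the second with \<open>x\<close> and \<open>y\<close> exchanged, remove
  the coincidences between distinct indices in either order; \<open>ne\<close> excludes those at
  equal indices.\<close>

lemma ultrafilter_disjoint_images:
  fixes x y :: "nat \<Rightarrow> 'a"
  assumes U: "ultrafilter U" and A: "eventually (\<lambda>n. n \<in> A) U"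
    and inj: "inj_on x A" "inj_on y A" and ne: "\<And>n. n \<in> A \<Longrightarrow> x n \<noteq> y n"
  obtains B where "eventually (\<lambda>n. n \<in> B) U" "B \<subseteq> A" "x ` B \<inter> y ` B = {}"
proof -
  obtain B where B: "eventually (\<lambda>n. n \<in> B) U" "B \<subseteq> A"
    "\<And>m n. m \<in> B \<Longrightarrow> n \<in> B \<Longrightarrow> m < n \<Longrightarrow> x n \<noteq> y m"
    using ultrafilter_separate_below[OF U A inj(2)] by metis
  have "inj_on x B" using inj(1) B(2) by (rule inj_on_subset)
  then obtain C where C: "eventually (\<lambda>n. n \<in> C) U" "C \<subseteq> B"
    "\<And>m n. m \<in> C \<Longrightarrow> n \<in> C \<Longrightarrow> m < n \<Longrightarrow> y n \<noteq> x m"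
    using ultrafilter_separate_below[OF U B(1)] by metis
  have "x n \<noteq> y m" if "m \<in> C" "n \<in> C" for m n
    using B(2) B(3)[of m n] C(2) C(3)[of n m] ne[of n] that
    by (metis linorder_neqE_nat subsetD)
  then have "x ` C \<inter> y ` C = {}" by auto
  then show ?thesis using that[of C] B(2) C(1,2) by blast
qed

section \<open>Open sets that tell two sequences apart\<close>

lemma ultra_opens_neqI:
  assumes U: "ultrafilter U" and "open W"
    and "eventually (\<lambda>n. x n \<in> W) U" "eventually (\<lambda>n. y n \<notin> W) U"
  shows "ultra_opens U x \<noteq> ultra_opens U y"
proof -
  have "W \<in> ultra_opens U x" "W \<notin> ultra_opens U y"
    using assms(2-4) ultrafilter_not_eventually_iff[OF U]
    by (auto simp: ultra_opens_def filter_sets_def)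
  then show ?thesis by blast
qed

text \<open>The values of \<open>y\<close> on \<open>B\<close> can accumulate only at
  \<open>L\<close>, so adjoining \<open>L\<close> makes the image closed.\<close>

lemma open_Compl_insert_limit:
  fixes y :: "'b \<Rightarrow> real"
  assumes fin: "\<And>e. e > 0 \<Longrightarrow> finite {n \<in> B. \<bar>y n - L\<bar> > e}"
  shows "open (- insert L (y ` B))"
proof (subst open_subopen, intro ballI)
  fix t assume t: "t \<in> - insert L (y ` B)"
  \<comment> \<open>Half the distance, so that \<open>t\<close> lies in the open region beyond
    \<open>e\<close> from \<open>L\<close>. This region misses \<open>L\<close> and meets the image
    in a finite set, which can be removed.\<close>
  define e where "e = \<bar>t - L\<bar> / 2"
  have e: "e > 0" "\<bar>t - L\<bar> > e" using t by (auto simp: e_def)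
  let ?T = "{s. \<bar>s - L\<bar> > e} - y ` {n \<in> B. \<bar>y n - L\<bar> > e}"
  have "open {s. \<bar>s - L\<bar> > e}"
    by (intro open_Collect_less continuous_intros)
  then have "open ?T"
    using fin[OF e(1)] by (intro open_Diff finite_imp_closed finite_imageI)
  moreover have "t \<in> ?T" "?T \<subseteq> - insert L (y ` B)" using t e by auto
  ultimately show "\<exists>T. open T \<and> t \<in> T \<and> T \<subseteq> - insert L (y ` B)" by blast
qed

lemma ultra_opens_neq_of_tendsto:
  assumes abs: "absolute_ultrafilter U"
    and x: "(x \<longlongrightarrow> L) U" and y: "(y \<longlongrightarrow> L) U"
    and ne: "eventually (\<lambda>n. x n \<noteq> y n) U"
  shows "ultra_opens U x \<noteq> ultra_opens U y"
proof -
  note U = absolute_ultrafilter_imp_ultrafilter[OF abs]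
  \<comment> \<open>Here the complement of the point \<open>L\<close> is the distinguishing set.
    Stating this for arbitrary \<open>u\<close> and \<open>v\<close> covers both \<open>x\<close>
    and \<open>y\<close> as the sequence that attains the limit.\<close>
  have limit_attained: "ultra_opens U u \<noteq> ultra_opens U v"
    if u: "eventually (\<lambda>n. u n = L) U" and uv: "eventually (\<lambda>n. u n \<noteq> v n) U" for u v
  proof -
    have "eventually (\<lambda>n. v n \<in> - {L}) U" "eventually (\<lambda>n. u n \<notin> - {L}) U"
      using u uv by (auto elim: eventually_elim2)
    then show ?thesis using ultra_opens_neqI[OF U, of "- {L}" v u] by auto
  qed
  consider "eventually (\<lambda>n. x n = L) U" | "eventually (\<lambda>n. y n = L) U"
    | "eventually (\<lambda>n. x n \<noteq> L) U" "eventually (\<lambda>n. y n \<noteq> L) U"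
    using ultrafilter_eventually_or[OF U] by blast
  then show ?thesis
  proof cases
    case 1
    then show ?thesis using limit_attained ne by blast
  next
    case 2
    then show ?thesis using limit_attained[of y x] ne by (simp add: eq_commute)
  next
    case 3
    obtain A where A: "eventually (\<lambda>n. n \<in> A) U" "inj_on x A" "\<And>n. n \<in> A \<Longrightarrow> x n \<noteq> L"
      using eventually_inj_discrete_along[OF abs x 3(1)] by metis
    obtain A' where A': "eventually (\<lambda>n. n \<in> A') U" "inj_on y A'"
      "\<And>e. e > 0 \<Longrightarrow> finite {n \<in> A'. \<bar>y n - L\<bar> > e}"
      using eventually_inj_discrete_along[OF abs y 3(2)] by metis
    let ?A = "{n \<in> A \<inter> A'. x n \<noteq> y n}"
    have "eventually (\<lambda>n. n \<in> ?A) U" using A(1) A'(1) ne by eventually_elim simp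
    moreover have "inj_on x ?A" "inj_on y ?A"
      using A(2) A'(2) by (auto intro: inj_on_subset)
    ultimately obtain B where B: "eventually (\<lambda>n. n \<in> B) U" "B \<subseteq> ?A" "x ` B \<inter> y ` B = {}"
      using ultrafilter_disjoint_images[OF U, of ?A x y] by blast
    let ?W = "- insert L (y ` B)"
    have "finite {n \<in> B. \<bar>y n - L\<bar> > e}" if "e > 0" for e
      by (rule finite_subset[OF _ A'(3)[OF that]]) (use B(2) in auto)
    then have "open ?W" by (rule open_Compl_insert_limit)
    moreover have "eventually (\<lambda>n. x n \<in> ?W) U"
      using B(1) by eventually_elim (use B(2,3) A(3) in auto)
    moreover have "eventually (\<lambda>n. y n \<notin> ?W) U"
      using B(1) by eventually_elim simp
    ultimately show ?thesis using ultra_opens_neqI[OF U] by blast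
  qed
qed

lemma ultra_opens_compose:
  assumes "continuous_on UNIV h" and "ultra_opens U x = ultra_opens U y"
  shows "ultra_opens U (\<lambda>n. h (x n)) = ultra_opens U (\<lambda>n. h (y n))"
proof -
  have "{n. h (x n) \<in> W} \<in> filter_sets U \<longleftrightarrow> {n. h (y n) \<in> W} \<in> filter_sets U"
    if "open W" for W
  proof -
    have "open (h -` W)" using assms(1) that by (simp add: open_vimage)
    moreover have "h -` W \<in> ultra_opens U x \<longleftrightarrow> h -` W \<in> ultra_opens U y"
      using assms(2) by simp
    ultimately show ?thesis by (simp add: ultra_opens_def)
  qed
  then show ?thesis by (auto simp: ultra_opens_def)
qed

text \<open>Composing with \<open>arctan\<close> loses nothing: by continuity the equality of the
  open-set families is kept, by injectivity so is the disagreement of the sequences, and bounded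
  values provide limits along \<open>U\<close>.\<close>

lemma ultra_opens_eq_imp_eventually_eq:
  assumes abs: "absolute_ultrafilter U" and eq: "ultra_opens U x = ultra_opens U y"
  shows "eventually (\<lambda>n. x n = y n) U"
proof (rule ccontr)
  note U = absolute_ultrafilter_imp_ultrafilter[OF abs]
  assume "\<not> eventually (\<lambda>n. x n = y n) U"
  then have ne: "eventually (\<lambda>n. arctan (x n) \<noteq> arctan (y n)) U"
    using ultrafilter_not_eventually_iff[OF U] by (simp add: arctan_eq_iff)
  let ?x = "\<lambda>n. arctan (x n)" and ?y = "\<lambda>n. arctan (y n)"
  have eq': "ultra_opens U ?x = ultra_opens U ?y"
    using eq by (rule ultra_opens_compose[rotated]) (intro continuous_intros)
  have bounded: "arctan t \<in> {- (pi / 2)..pi / 2}" for t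
    using arctan_bounded[of t] by auto
  obtain L where L: "(?x \<longlongrightarrow> L) U"
    using ultrafilter_tendsto_compact[OF U compact_Icc bounded] by blast
  obtain M where M: "(?y \<longlongrightarrow> M) U"
    using ultrafilter_tendsto_compact[OF U compact_Icc bounded] by blast
  show False
  proof (cases "L = M")
    case True
    then show False using ultra_opens_neq_of_tendsto[OF abs L _ ne] M eq' by blast
  next
    case False
    then obtain S T where "open S" "open T" "L \<in> S" "M \<in> T" and ST: "S \<inter> T = {}"
      using hausdorff by metis
    then have "eventually (\<lambda>n. ?x n \<in> S) U" and T: "eventually (\<lambda>n. ?y n \<in> T) U"
      using topological_tendstoD L M by blast+
    moreover have "eventually (\<lambda>n. ?y n \<notin> S) U"
      using T by eventually_elim (use ST in auto)
    ultimately show False using ultra_opens_neqI[OF U \<open>open S\<close>, of ?x ?y] eq' by simp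
  qed
qed

lemma eventually_eq_imp_ultra_opens_eq:
  assumes "eventually (\<lambda>n. x n = y n) U"
  shows "ultra_opens U x = ultra_opens U y"
proof -
  have "eventually (\<lambda>n. x n \<in> W) U \<longleftrightarrow> eventually (\<lambda>n. y n \<in> W) U" for W
    by (rule eventually_cong[OF assms]) simp
  then show ?thesis by (simp add: ultra_opens_def filter_sets_def)
qed

theorem theorem3p6:
  fixes U :: "nat filter" and x y :: "nat \<Rightarrow> real"
  assumes "absolute_ultrafilter U"
  shows "ultra_opens U x = ultra_opens U y \<longleftrightarrow> hyperreal_class U x = hyperreal_class U y"
proof -
  have "hyperreal_class U x = hyperreal_class U y \<longleftrightarrow> eventually (\<lambda>n. x n = y n) U"
    unfolding hyperreal_class_def
    using eq_equiv_class_iff[OF equiv_seq_equiv, of x y U]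
    by (simp add: seq_equiv_def filter_sets_def)
  then show ?thesis
    using ultra_opens_eq_imp_eventually_eq[OF assms] eventually_eq_imp_ultra_opens_eq by blast
qed

end
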